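(* The discrete initial value problem $$\triangle f(n) = \frac{1}{n^{2}} \quad \text{for integers } n\geq 2, \qquad f(2) = 2,$$ for an unknown real-valued sequence $f(n)$, $n\ge 2$, has solution given by $$f(n) = 1+\sum_{k=1}^{n-1}\frac{1}{k^{2}} \quad (n\geq 2).$$
   Context: For a real-valued sequence $f$, the first order difference is defined by $\triangle f(n) := f(n+1)-f(n)$. *)

theory Defs
  imports Complex_Main
begin

definition forward_difference :: "(nat \<Rightarrow> real) \<Rightarrow> nat \<Rightarrow> real" where
  "forward_difference f n = f (n + 1) - f n"

end

theory Submission
  imports Defs
begin

text \<open>Summation inverts the forward difference: the sums of \<open>g\<close> up to \<open>n - 1\<close> have
  forward difference \<open>g n\<close>, and a first-order difference equation determines a sequence from its
  initial value. The initial value 2 splits as \<open>1 + 1 / 1\<^sup>2\<close>, so the sum can start at \<open>k = 1\<close>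
  although the equation itself only contributes the terms with \<open>k \<ge> 2\<close>.\<close>

lemma forward_difference_iff_sum:
  fixes f g :: "nat \<Rightarrow> real"
  assumes "a \<le> m" and "1 \<le> m"
  shows "((\<forall>n\<ge>m. forward_difference f n = g n) \<and> f m = c + (\<Sum>k = a..m - 1. g k)) \<longleftrightarrow>
         (\<forall>n\<ge>m. f n = c + (\<Sum>k = a..n - 1. g k))"
    (is "?ivp \<longleftrightarrow> ?solution")
proof -
  \<comment> \<open>The truncated upper bound \<open>n - 1\<close> is harmless because \<open>n\<close> is positive.\<close>
  have sum_step: "(\<Sum>k = a..n + 1 - 1. g k) = (\<Sum>k = a..n - 1. g k) + g n" if "n \<ge> m" for n
    using that assms by (cases n) auto
  show ?thesis
  proof
    assume ivp: ?ivp
    have "f n = c + (\<Sum>k = a..n - 1. g k)" if "n \<ge> m" for n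
      using that
    proof (induction n rule: dec_induct)
      case base
      show ?case using ivp by blast
    next
      case (step n)
      have "f (n + 1) = f n + g n"
        using ivp step.hyps by (auto simp: forward_difference_def algebra_simps)
      then show ?case
        using step.IH sum_step[OF step.hyps(1)] by simp
    qed
    then show ?solution by blast
  next
    assume solution: ?solution
    have "forward_difference f n = g n" if "n \<ge> m" for n
    proof -
      have "f (n + 1) = c + (\<Sum>k = a..n + 1 - 1. g k)" and "f n = c + (\<Sum>k = a..n - 1. g k)"
        using solution that by (blast intro: trans_le_add1)+
      then show ?thesis
        using sum_step[OF that] by (simp add: forward_difference_def)
    qed
    with solution show ?ivp by blast
  qed
qed

theorem proposition5:
  fixes f :: "nat \<Rightarrow> real"
  shows "((\<forall>n\<ge>2. forward_difference f n = 1 / (real n)\<^sup>2) \<and> f 2 = 2) \<longleftrightarrow>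
         (\<forall>n\<ge>2. f n = 1 + (\<Sum>k = 1..n - 1. 1 / (real k)\<^sup>2))"
  using forward_difference_iff_sum[of 1 2 f "\<lambda>k. 1 / (real k)\<^sup>2" 1] by simp

end
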